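(* Let $q$ be an odd prime power and let $m\ge 4$ be an even integer. Then the graph $\mathfrak{G}_{m,q}$ is strongly regular with parameters $(v,k,\lambda,\mu)$, where $$v=q^m,$$ $$k=\begin{cases}\frac12\left(q^m+q^{m-1}+q^{m/2}-q^{m/2-1}\right)-1 & \text{if } q\equiv 1 \pmod 4,\\ \frac12\left(q^m+q^{m-1}+(-q)^{m/2}+(-q)^{m/2-1}\right)-1 & \text{if } q\equiv 3 \pmod 4,\end{cases}$$ $$\lambda=\tfrac14\left(q^{m-2}(q+1)^2+2(-1)^{m(q-1)/4}q^{m/2-1}(q-1)\right)-2,$$ $$\mu=\begin{cases}\frac14 q^{m/2-1}(q+1)\left(q^{m/2}+q^{m/2-1}+2\right) & \text{if } q\equiv 1 \pmod 4,\\ \frac14 q^{m/2-1}(q+1)\left(q^{m/2}+q^{m/2-1}+2(-1)^{m/2}\right) & \text{if } q\equiv 3 \pmod 4.\end{cases}$$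
   Context: $\mathbb{F}_q$ is the finite field of odd order $q$. The graph $\mathfrak{G}_{m,q}$ has as vertices the points of the affine space $AG(m,q)$, i.e. the vectors of $\mathbb{F}_q^m$; two distinct vertices $\mathbf{x}=(x_1,\ldots,x_m)$ and $\mathbf{y}=(y_1,\ldots,y_m)$ are adjacent if and only if $d(\mathbf{x},\mathbf{y})=\sum_{i=1}^m (x_i-y_i)^2$ is a square in $\mathbb{F}_q$ (zero included). A graph with $v$ vertices is strongly regular with parameters $(v,k,\lambda,\mu)$ if every vertex has exactly $k$ neighbors, every pair of adjacent vertices has exactly $\lambda$ common neighbors, and every pair of distinct non-adjacent vertices has exactly $\mu$ common neighbors. *)

theory Defs
  imports
    "HOL-Analysis.Finite_Cartesian_Product"
    "HOL-Computational_Algebra.Nth_Powers"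
    "HOL-Number_Theory.Prime_Powers"
    "HOL-Number_Theory.Cong"
    "Graph_Theory.Pair_Digraph"
begin

definition neighbors :: "'v pair_pre_digraph \<Rightarrow> 'v \<Rightarrow> 'v set" where
  "neighbors G x = {y \<in> pverts G. (x, y) \<in> parcs G}"

(* pair_graph is the library's finite simple graph: the arc relation is symmetric and
   loop-free. Complete and empty graphs are not excluded. *)
definition strongly_regular ::
  "'v pair_pre_digraph \<Rightarrow> nat \<Rightarrow> nat \<Rightarrow> nat \<Rightarrow> nat \<Rightarrow> bool" where
  "strongly_regular G v k l mu \<longleftrightarrow>
     pair_graph G \<and>
     card (pverts G) = v \<and>
     (\<forall>x\<in>pverts G. card (neighbors G x) = k) \<and>
     (\<forall>x\<in>pverts G. \<forall>y\<in>pverts G. (x, y) \<in> parcs G \<longrightarrow>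
        card (neighbors G x \<inter> neighbors G y) = l) \<and>
     (\<forall>x\<in>pverts G. \<forall>y\<in>pverts G. x \<noteq> y \<and> (x, y) \<notin> parcs G \<longrightarrow>
        card (neighbors G x \<inter> neighbors G y) = mu)"

definition sq_dist :: "'a::field ^ 'm \<Rightarrow> 'a ^ 'm \<Rightarrow> 'a" where
  "sq_dist x y = (\<Sum>i\<in>UNIV. (x $ i - y $ i)\<^sup>2)"

(* The finite field is the type 'a, the dimension m is CARD('m); is_square 0 holds. *)
definition quadrance_graph :: "('a::{field,finite} ^ 'm) pair_pre_digraph" where
  "quadrance_graph =
     \<lparr>pverts = UNIV, parcs = {(x, y). x \<noteq> y \<and> is_square (sq_dist x y)}\<rparr>"

end

theory Submission
  imports Defs Complex_Main "HOL-Library.Disjoint_Sets" "HOL-Library.Z2"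
begin

text \<open>The graph is a Cayley graph of the additive group of \<open>F\<^sup>m\<close>, with connection set
  \<open>S = {x \<noteq> 0. \<Sum>\<^sub>i x\<^sub>i\<^sup>2 is a square}\<close>. Let \<open>\<psi>\<close> be a nontrivial additive character of \<open>F\<close>. For even \<open>m\<close> the
  Fourier transform of the indicator \<open>f\<close> of \<open>S \<union> {0}\<close> reduces to Gauss sums and takes only two
  values away from the origin. Hence off the origin it satisfies a quadratic equation, which
  inverts to an expression of the convolution \<open>f * f\<close> at \<open>a \<noteq> 0\<close> as a linear function of \<open>f a\<close>.
  That convolution counts common neighbours.\<close>

section \<open>Squares in finite fields of odd order\<close>

text \<open>The involution pairs up the terms of the sum of 1 over \<open>S\<close>, so the sum
  vanishes in the two-element field \<open>bit\<close>, where it records \<open>card S\<close>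
  modulo 2.\<close>

lemma even_card_involution:
  assumes "\<And>x. x \<in> S \<Longrightarrow> f x \<in> S" and "\<And>x. x \<in> S \<Longrightarrow> f (f x) = x"
    and "\<And>x. x \<in> S \<Longrightarrow> f x \<noteq> x"
  shows "even (card S)"
proof -
  have "(\<Sum>x\<in>S. 1 :: bit) = 0"
    by (rule sum_involution_eq_0[where h = f]) (use assms in auto)
  then have "even (of_nat (card S) :: bit)" by simp
  then show ?thesis by (simp only: even_of_nat_iff)
qed

lemma is_square_iff: "is_square x \<longleftrightarrow> (\<exists>y. x = y\<^sup>2)"
  by (auto simp: is_nth_power_def)

text \<open>If 2 were 0, then \<open>x \<mapsto> x + 1\<close> would be a fixed-point-free
  involution of a set of odd size.\<close>

lemma two_neq_zero_if_odd_card: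
  assumes "odd (CARD('a::{field,finite}))"
  shows "(2::'a) \<noteq> 0"
proof
  assume two: "(2::'a) = 0"
  have "even (card (UNIV :: 'a set))"
  proof (rule even_card_involution[where f = "\<lambda>x. x + 1"])
    show "x + 1 + 1 = x" for x :: 'a
      using two by (simp add: add.assoc)
  qed auto
  with assms show False by simp
qed

lemma minus_neq_self:
  assumes "(2::'a::field) \<noteq> 0" and "x \<noteq> 0"
  shows "- x \<noteq> (x::'a)"
proof
  assume "- x = x"
  then have "2 * x = 0" by (metis add.right_inverse mult_2)
  with assms show False by simp
qed

lemma card_field_ge_2: "CARD('a::{field,finite}) \<ge> 2"
proof -
  have "card {0, 1::'a} \<le> CARD('a)" by (rule card_mono) auto
  then show ?thesis by simp
qed

section \<open>The quadratic character\<close>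

text \<open>The Legendre symbol of the field, with complex values so that it can be multiplied with
  additive characters.\<close>

definition quad_char :: "'a::field \<Rightarrow> complex" where
  "quad_char x = (if x = 0 then 0 else if is_square x then 1 else -1)"

lemma quad_char_0 [simp]: "quad_char 0 = 0"
  by (simp add: quad_char_def)

lemma quad_char_sq: "x \<noteq> 0 \<Longrightarrow> (quad_char x)\<^sup>2 = 1"
  by (simp add: quad_char_def)

lemma is_square_mult_square_iff:
  fixes x y :: "'a::field"
  assumes "y \<noteq> 0"
  shows "is_square (x * y\<^sup>2) \<longleftrightarrow> is_square x"
proof
  assume "is_square (x * y\<^sup>2)"
  then obtain z where "x * y\<^sup>2 = z\<^sup>2" by (auto simp: is_square_iff)
  then have "x = (z / y)\<^sup>2" using assms by (simp add: power_divide field_simps)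
  then show "is_square x" by (auto simp: is_square_iff)
qed (auto simp: is_square_iff simp flip: power_mult_distrib)

lemma quad_char_mult_square:
  fixes x y :: "'a::field"
  assumes "y \<noteq> 0"
  shows "quad_char (x * y\<^sup>2) = quad_char x"
  using is_square_mult_square_iff[OF assms, of x] assms by (simp add: quad_char_def)

text \<open>Group the sum by the value of the square: the fibre over \<open>u\<close> is
  \<open>{y, -y}\<close> or empty, so it has \<open>1 + quad_char u\<close> elements, also at
  \<open>u = 0\<close>.\<close>

lemma sum_over_squares:
  fixes h :: "'a::{field,finite} \<Rightarrow> complex"
  assumes two: "(2::'a) \<noteq> 0"
  shows "(\<Sum>c\<in>UNIV. h (c\<^sup>2)) = (\<Sum>u\<in>UNIV. (1 + quad_char u) * h u)"
proof -
  have fibre: "of_nat (card {c::'a. c\<^sup>2 = u}) = 1 + quad_char u" for u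
  proof (cases "is_square u")
    case True
    then obtain y where y: "u = y\<^sup>2" by (auto simp: is_square_iff)
    have "{c::'a. c\<^sup>2 = u} = {y, -y}" using y by (auto simp: power2_eq_iff)
    then show ?thesis using minus_neq_self[OF two, of y] y True by (auto simp: quad_char_def)
  next
    case False
    then have "{c::'a. c\<^sup>2 = u} = {}" by (auto simp: is_square_iff)
    then show ?thesis using False by (auto simp: quad_char_def)
  qed
  have "(\<Sum>c\<in>UNIV. h (c\<^sup>2)) = (\<Sum>u\<in>UNIV. \<Sum>c\<in>{c. c \<in> UNIV \<and> c\<^sup>2 = u}. h (c\<^sup>2))"
    by (rule sum.group[symmetric]) auto
  also have "\<dots> = (\<Sum>u\<in>UNIV. of_nat (card {c::'a. c\<^sup>2 = u}) * h u)"
    by (intro sum.cong refl) simp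
  finally show ?thesis by (simp add: fibre)
qed

lemma sum_quad_char:
  assumes two: "(2::'a::{field,finite}) \<noteq> 0"
  shows "(\<Sum>u\<in>(UNIV::'a set). quad_char u) = 0"
  using sum_over_squares[OF two, of "\<lambda>_. 1"] by (simp add: sum.distrib)

lemma bij_mult_left: "(a::'a::field) \<noteq> 0 \<Longrightarrow> bij ((*) a)"
  by (rule o_bij[where g = "(*) (inverse a)"]) (auto simp: fun_eq_iff)

text \<open>For a non-square \<open>a\<close> every term of \<open>\<Sum>\<^sub>u (quad_char u + quad_char (a u))\<close> is nonpositive,
  while the sum vanishes; hence each term vanishes.\<close>
lemma quad_char_mult:
  fixes x y :: "'a::{field,finite}"
  assumes two: "(2::'a) \<noteq> 0"
  shows "quad_char (x * y) = quad_char x * quad_char y"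
proof (cases "x = 0 \<or> y = 0")
  case False
  show ?thesis
  proof (cases "is_square x")
    case True
    then obtain z where "x = z\<^sup>2" by (auto simp: is_square_iff)
    then show ?thesis using False quad_char_mult_square[of z y] True
      by (auto simp: mult.commute quad_char_def)
  next
    case nsq: False
    have sq: "quad_char (x * u) = - 1" if "is_square u" "u \<noteq> 0" for u
    proof -
      obtain z where "u = z\<^sup>2" using \<open>is_square u\<close> by (auto simp: is_square_iff)
      then show ?thesis using False nsq that quad_char_mult_square[of z x]
        by (auto simp: quad_char_def)
    qed
    \<comment> \<open>Negated real parts turn the vanishing sum into one of nonnegative
      reals.\<close>
    let ?h = "\<lambda>u. - (Re (quad_char u) + Re (quad_char (x * u)))"
    have "(\<Sum>u\<in>UNIV. quad_char (x * u)) = (\<Sum>u\<in>(UNIV::'a set). quad_char u)"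
      using False by (intro sum.reindex_bij_betw bij_mult_left) auto
    then have "(\<Sum>u\<in>UNIV. quad_char u + quad_char (x * u)) = 0"
      using sum_quad_char[OF two] by (simp add: sum.distrib)
    then have "(\<Sum>u\<in>UNIV. ?h u) = 0"
      by (metis (no_types, lifting) Re_sum add.inverse_neutral plus_complex.sel(1) sum.cong
          sum_negf zero_complex.sel(1))
    moreover have "?h u \<ge> 0" for u
      by (cases "u = 0"; cases "is_square u") (auto simp: sq, auto simp: quad_char_def)
    ultimately have "\<forall>u\<in>UNIV. ?h u = 0"
      by (subst sum_nonneg_eq_0_iff[symmetric]) auto
    then have "?h y = 0" by (rule bspec) simp
    then show ?thesis using nsq False
      by (cases "is_square y") (auto simp: sq, auto simp: quad_char_def split: if_splits)
  qed
qed auto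

text \<open>The order of the field is \<open>1 + 2 * card S\<close>, where \<open>S\<close> is the
  set of nonzero squares, so the parity of \<open>card S\<close> decides. If -1 is a square,
  negation acts on \<open>S\<close> without fixed points; otherwise inversion fixes only 1 in
  \<open>S\<close>.\<close>

lemma is_square_minus_one_iff:
  assumes odd: "odd (CARD('a::{field,finite}))"
  shows "is_square (-1::'a) \<longleftrightarrow> CARD('a) mod 4 = 1"
proof -
  note two = two_neq_zero_if_odd_card[OF odd]
  define S where "S = {x::'a. x \<noteq> 0 \<and> is_square x}"
  have "(\<Sum>u\<in>(UNIV::'a set). 1 + quad_char u) = of_nat (card {0::'a} + 2 * card S)"
  proof -
    have "(\<Sum>u\<in>(UNIV::'a set). 1 + quad_char u)
        = (\<Sum>u\<in>UNIV. (if u \<in> {0} then 1 else 0) + 2 * (if u \<in> S then 1 else 0))"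
      by (intro sum.cong) (auto simp: S_def quad_char_def)
    also have "\<dots> = of_nat (card {0::'a} + 2 * card S)"
      by (simp add: sum.distrib sum.If_cases flip: sum_distrib_left)
    finally show ?thesis .
  qed
  then have "(of_nat (CARD('a)) :: complex) = of_nat (card {0::'a} + 2 * card S)"
    using sum_quad_char[OF two] by (simp add: sum.distrib)
  then have card: "CARD('a) = 1 + 2 * card S"
    unfolding of_nat_eq_iff by simp
  show ?thesis
  proof (cases "is_square (-1::'a)")
    case True
    have "even (card S)"
    proof (rule even_card_involution[where f = uminus])
      show "- x \<in> S" if "x \<in> S" for x
        using that True is_nth_power_mult[OF True, of x] by (auto simp: S_def)
    qed (auto simp: S_def minus_neq_self[OF two])
    then show ?thesis using card True by (auto elim!: evenE)
  next
    case False
    have "even (card (S - {1}))"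
    proof (rule even_card_involution[where f = inverse])
      fix x assume x: "x \<in> S - {1}"
      then obtain z where "x = z\<^sup>2" "z \<noteq> 0" by (auto simp: S_def is_square_iff)
      then have "inverse x = (inverse z)\<^sup>2" by (simp add: power_inverse)
      moreover have "inverse x \<noteq> 1" using x by simp
      ultimately show "inverse x \<in> S - {1}"
        using x \<open>z \<noteq> 0\<close> by (auto simp: S_def is_square_iff)
      show "inverse x \<noteq> x"
      proof
        assume "inverse x = x"
        then have "x\<^sup>2 = 1" using x by (auto simp: S_def power2_eq_square field_simps)
        then have "x = -1" using x by (auto simp: power2_eq_1_iff)
        then show False using x False by (auto simp: S_def)
      qed
    qed auto
    moreover have "card S = card (S - {1}) + 1"
      by (subst card.remove[of S 1]) (auto simp: S_def)
    ultimately have "odd (card S)" by simp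
    then have "CARD('a) mod 4 = 3" using card by (auto elim!: oddE)
    then show ?thesis using False by simp
  qed
qed

section \<open>A nontrivial additive character\<close>

definition add_subgroup :: "'a::ab_group_add set \<Rightarrow> bool" where
  "add_subgroup A \<longleftrightarrow> 0 \<in> A \<and> (\<forall>x\<in>A. \<forall>y\<in>A. x + y \<in> A) \<and> (\<forall>x\<in>A. - x \<in> A)"

lemma add_subgroup_of_nat_mult:
  fixes A :: "'a::comm_ring_1 set"
  assumes "add_subgroup A" "x \<in> A"
  shows "of_nat n * x \<in> A"
  using assms by (induction n) (auto simp: add_subgroup_def distrib_right)

text \<open>Take a maximal proper additive subgroup \<open>A\<close> and \<open>g \<notin> A\<close>. Every element is \<open>a + k g\<close> with
  \<open>a \<in> A\<close> and \<open>k\<close> unique modulo the characteristic \<open>p\<close>, so \<open>a + k g \<mapsto> exp (2 \<pi> i k / p)\<close> is a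
  well-defined character.\<close>
lemma exists_additive_character:
  "\<exists>\<psi> :: 'a::{field,finite} \<Rightarrow> complex.
    (\<forall>x y. \<psi> (x + y) = \<psi> x * \<psi> y) \<and> (\<forall>x. \<psi> x \<noteq> 0) \<and> (\<exists>x. \<psi> x \<noteq> 1)"
proof -
  define p where "p = CHAR('a)"
  have p: "prime p" unfolding p_def by (intro prime_CHAR_semidom finite_imp_CHAR_pos) simp
  have p0: "(of_nat p :: 'a) = 0" by (simp add: p_def)
  define P where "P = {A :: 'a set. add_subgroup A \<and> A \<noteq> UNIV}"
  have "{0} \<in> P"
  proof -
    have "(1::'a) \<notin> {0}" by simp
    then have "{0::'a} \<noteq> UNIV" by blast
    then show ?thesis by (simp add: P_def add_subgroup_def)
  qed
  then obtain A where A: "A \<in> P" and max: "\<And>B. B \<in> P \<Longrightarrow> A \<subseteq> B \<Longrightarrow> B = A"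
    using finite_has_maximal[of P] by (metis empty_iff finite)
  then have sub: "add_subgroup A" and "A \<noteq> UNIV" by (auto simp: P_def)
  then obtain g where g: "g \<notin> A" by blast
  \<comment> \<open>The subgroup generated by \<open>A\<close> and \<open>g\<close>, equal to the
    whole field by maximality of \<open>A\<close>. Natural multiples suffice, since the factor
    \<open>p - 1\<close> negates.\<close>
  define B where "B = {a + of_nat k * g | a k. a \<in> A}"
  have "add_subgroup B"
    unfolding add_subgroup_def
  proof (intro conjI ballI)
    show "0 \<in> B" using sub by (force simp: B_def add_subgroup_def intro: exI[of _ 0])
  next
    fix x y assume "x \<in> B" "y \<in> B"
    then obtain a k b l where "x = a + of_nat k * g" "y = b + of_nat l * g" "a \<in> A" "b \<in> A"
      by (auto simp: B_def)
    then have "x + y = (a + b) + of_nat (k + l) * g" "a + b \<in> A"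
      using sub by (auto simp: add_subgroup_def algebra_simps)
    then show "x + y \<in> B" unfolding B_def by blast
  next
    fix x assume "x \<in> B"
    then obtain a k where x: "x = a + of_nat k * g" "a \<in> A" by (auto simp: B_def)
    have "of_nat (k * p) = (0 :: 'a)" using p0 by simp
    moreover have "k * p = k * (p - 1) + k"
      using prime_gt_0_nat[OF p] by (cases p) auto
    ultimately have "of_nat (k * (p - 1)) = - (of_nat k :: 'a)"
      by (metis add_eq_0_iff2 of_nat_add)
    then have "- x = - a + of_nat (k * (p - 1)) * g" using x by simp
    moreover have "- a \<in> A" using x sub by (auto simp: add_subgroup_def)
    ultimately show "- x \<in> B" unfolding B_def by blast
  qed
  moreover have "A \<subseteq> B" by (force simp: B_def intro: exI[of _ 0])
  moreover have "g \<in> B"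
    using sub by (force simp: B_def add_subgroup_def intro: exI[of _ 0] exI[of _ 1])
  ultimately have "B = UNIV" using max[of B] g unfolding P_def by blast
  then have "\<exists>k. x - of_nat k * g \<in> A" for x
  proof -
    obtain a k where "x = a + of_nat k * g" "a \<in> A" using \<open>B = UNIV\<close> unfolding B_def by blast
    then show ?thesis by (auto intro!: exI[of _ k])
  qed
  then obtain \<kappa> where \<kappa>: "\<And>x. x - of_nat (\<kappa> x) * g \<in> A" by metis
  \<comment> \<open>This makes \<open>\<kappa>\<close> unique modulo \<open>p\<close>: otherwise an
    inverse \<open>u\<close> of \<open>l - k\<close> modulo \<open>p\<close> would recover
    \<open>g\<close> as an element of \<open>A\<close>.\<close>
  have le: "p dvd l - k" if "of_nat k * g - of_nat l * g \<in> A" "k \<le> l" for k l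
  proof (rule ccontr)
    assume "\<not> p dvd l - k"
    then have "coprime (l - k) p" using p prime_imp_coprime coprime_commute by blast
    then obtain u where "[(l - k) * u = 1] (mod p)" using cong_solve_coprime_nat by fastforce
    then have "of_nat ((l - k) * u) = (1 :: 'a)"
      unfolding p_def by (metis of_nat_1 of_nat_eq_iff_cong_CHAR)
    moreover have "of_nat u * (- (of_nat k * g - of_nat l * g)) \<in> A"
      using that(1) sub by (intro add_subgroup_of_nat_mult) (auto simp: add_subgroup_def)
    moreover have "of_nat u * (- (of_nat k * g - of_nat l * g)) = of_nat ((l - k) * u) * g"
      using that(2) by (simp add: of_nat_diff algebra_simps)
    ultimately show False using g by simp
  qed
  have cong: "[k = l] (mod p)" if "of_nat k * g - of_nat l * g \<in> A" for k l
  proof (cases "k \<le> l")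
    case True
    then show ?thesis using le[OF that] by (metis cong_altdef_nat cong_sym)
  next
    case False
    have "of_nat l * g - of_nat k * g \<in> A" using that sub by (metis add_subgroup_def minus_diff_eq)
    then show ?thesis using le[of l k] False by (simp add: cong_altdef_nat)
  qed
  define \<zeta> where "\<zeta> = cis (2 * pi / real p)"
  have \<zeta>p: "\<zeta> ^ p = 1" using prime_gt_0_nat[OF p] by (simp add: \<zeta>_def DeMoivre)
  have \<zeta>_cong: "\<zeta> ^ k = \<zeta> ^ l" if "[k = l] (mod p)" for k l
  proof -
    have "\<zeta> ^ k = \<zeta> ^ (k mod p)" for k
      by (metis \<zeta>p div_mult_mod_eq mult.commute mult_1 power_add power_mult power_one)
    then show ?thesis using that unfolding cong_def by metis
  qed
  show ?thesis
  proof (intro exI[of _ "\<lambda>x. \<zeta> ^ \<kappa> x"] conjI allI)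
    fix x y
    \<comment> \<open>In this combination \<open>x\<close> and \<open>y\<close> cancel, leaving only
      multiples of \<open>g\<close>, so \<open>\<kappa>\<close> is additive modulo
      \<open>p\<close>.\<close>
    have "- ((x + y) - of_nat (\<kappa> (x + y)) * g) + ((x - of_nat (\<kappa> x) * g) + (y - of_nat (\<kappa> y) * g)) \<in> A"
      using sub \<kappa> unfolding add_subgroup_def by blast
    then have "of_nat (\<kappa> (x + y)) * g - of_nat (\<kappa> x + \<kappa> y) * g \<in> A"
      by (simp add: algebra_simps)
    then show "\<zeta> ^ \<kappa> (x + y) = \<zeta> ^ \<kappa> x * \<zeta> ^ \<kappa> y"
      using \<zeta>_cong cong by (metis power_add)
  next
    show "\<zeta> ^ \<kappa> x \<noteq> 0" for x by (simp add: \<zeta>_def)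
  next
    have "- (g - of_nat (\<kappa> g) * g) \<in> A" using sub \<kappa> unfolding add_subgroup_def by blast
    then have "[\<kappa> g = 1] (mod p)" by (intro cong) simp
    then have "\<zeta> ^ \<kappa> g = \<zeta>" using \<zeta>_cong by fastforce
    moreover have "\<zeta> \<noteq> 1"
    proof
      assume "\<zeta> = 1"
      then have "cos (2 * pi / real p) = 1" by (simp add: \<zeta>_def complex_eq_iff)
      then obtain n :: int where "2 * pi / real p = of_int n * 2 * pi"
        by (auto simp: cos_one_2pi_int)
      then have "of_int n * real p = 1" using prime_gt_0_nat[OF p] by (simp add: field_simps)
      then have "n * int p = 1" by (metis of_int_eq_1_iff of_int_mult of_int_of_nat_eq)
      then have "int p dvd 1" by (metis dvd_triv_right)
      then show False using prime_gt_1_nat[OF p] by simp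
    qed
    ultimately show "\<exists>x. \<zeta> ^ \<kappa> x \<noteq> 1" by metis
  qed
qed

section \<open>Gauss sums\<close>

text \<open>Distributivity, with vectors as choice functions. It splits character sums over the
  vector space into one-dimensional ones.\<close>

lemma sum_vec_prod:
  fixes h :: "'m::finite \<Rightarrow> 'a::finite \<Rightarrow> 'b::comm_semiring_1"
  shows "(\<Sum>x\<in>(UNIV :: ('a ^ 'm) set). \<Prod>i\<in>UNIV. h i (x $ i)) = (\<Prod>i\<in>UNIV. \<Sum>c\<in>UNIV. h i c)"
proof -
  have "(\<Prod>i\<in>UNIV. \<Sum>c\<in>UNIV. h i c) = (\<Sum>g\<in>UNIV. \<Prod>i\<in>UNIV. h i (g i))"
    by (simp add: prod_sum_PiE)
  also have "\<dots> = (\<Sum>x\<in>UNIV. \<Prod>i\<in>UNIV. h i ((x :: 'a ^ 'm) $ i))"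
    by (rule sum.reindex_bij_betw[symmetric])
       (auto intro!: bij_betwI[of _ _ _ vec_lambda] simp: vec_eq_iff)
  finally show ?thesis ..
qed

definition qform :: "'a::field ^ 'm \<Rightarrow> 'a" where
  "qform x = (\<Sum>i\<in>UNIV. (x $ i)\<^sup>2)"

definition dot :: "'a::field ^ 'm \<Rightarrow> 'a ^ 'm \<Rightarrow> 'a" where
  "dot x y = (\<Sum>i\<in>UNIV. x $ i * y $ i)"

lemma dot_diff_right: "dot x (y - z) = dot x y - dot x z"
  by (simp add: dot_def right_diff_distrib sum_subtractf)

lemma dot_commute: "dot x y = dot y x"
  by (simp add: dot_def mult.commute)

lemma qform_0 [simp]: "qform (0 :: 'a::field ^ 'm::finite) = 0"
  by (simp add: qform_def)

lemma qform_diff_commute: "qform (x - y) = qform (y - x)"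
  by (simp add: qform_def power2_commute)

definition sq_ind :: "'a::field \<Rightarrow> complex" where
  "sq_ind c = of_bool (is_square c)"

text \<open>The last summand corrects the value at 0, which counts as a square although
  \<open>quad_char\<close> vanishes there.\<close>

lemma sq_ind_quad_char: "sq_ind c = (1 + quad_char c + of_bool (c = 0)) / 2"
  by (auto simp: sq_ind_def quad_char_def)

text \<open>Here \<open>q\<close> is the field order as a complex number, which keeps all identities
  below inside the complex numbers.\<close>

locale additive_character =
  fixes \<psi> :: "'a::{field,finite} \<Rightarrow> complex" and q :: complex
  assumes card_eq [simp]: "of_nat (CARD('a)) = q"
    and add: "\<psi> (x + y) = \<psi> x * \<psi> y"
    and nonzero: "\<psi> x \<noteq> 0"
    and nontrivial: "\<exists>x. \<psi> x \<noteq> 1"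
    and two: "(2::'a) \<noteq> 0"
begin

lemma q_nonzero [simp]: "q \<noteq> 0"
  unfolding card_eq[symmetric] by (simp del: card_eq)

lemma four: "(4::'a) \<noteq> 0"
proof -
  have "(4::'a) = 2 * 2" by simp
  then show ?thesis using two by (metis mult_eq_0_iff)
qed

lemma zero [simp]: "\<psi> 0 = 1"
  using add[of 0 0] nonzero[of 0] by simp

text \<open>Orthogonality: for \<open>c \<noteq> 0\<close>, shifting by \<open>z / c\<close>
  multiplies the sum by \<open>\<psi> z \<noteq> 1\<close>.\<close>

lemma sum_psi: "(\<Sum>x\<in>UNIV. \<psi> (c * x)) = q * of_bool (c = 0)"
proof (cases "c = 0")
  case False
  obtain z where z: "\<psi> z \<noteq> 1" using nontrivial by blast
  have "(\<Sum>x\<in>UNIV. \<psi> (c * x)) = (\<Sum>x\<in>UNIV. \<psi> (c * (x + z / c)))"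
    by (intro sum.reindex_bij_betw[symmetric] bij_plus_right)
  also have "\<dots> = (\<Sum>x\<in>UNIV. \<psi> (c * x)) * \<psi> z"
    using False by (simp add: distrib_left add sum_distrib_right)
  finally show ?thesis using z False by simp
qed simp

lemma psi_sum: "finite I \<Longrightarrow> \<psi> (\<Sum>i\<in>I. f i) = (\<Prod>i\<in>I. \<psi> (f i))"
  by (induction I rule: finite_induct) (auto simp: add)

definition gauss :: complex where
  "gauss = (\<Sum>u\<in>UNIV. quad_char u * \<psi> u)"

text \<open>For \<open>t \<noteq> 0\<close> rescale \<open>u\<close> by \<open>t\<close> and use
  multiplicativity; for \<open>t = 0\<close> the sum of \<open>quad_char\<close> vanishes.\<close>

lemma twisted_gauss: "(\<Sum>u\<in>UNIV. quad_char u * \<psi> (t * u)) = quad_char t * gauss"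
proof (cases "t = 0")
  case True
  then show ?thesis using sum_quad_char[OF two] by simp
next
  case False
  have "gauss = (\<Sum>u\<in>UNIV. quad_char (t * u) * \<psi> (t * u))"
    unfolding gauss_def using False
    by (intro sum.reindex_bij_betw[symmetric] bij_mult_left)
  then have "quad_char t * gauss = (\<Sum>u\<in>UNIV. (quad_char t)\<^sup>2 * quad_char u * \<psi> (t * u))"
    by (simp add: quad_char_mult[OF two] sum_distrib_left power2_eq_square mult.assoc)
  then show ?thesis using quad_char_sq[OF False] by simp
qed

text \<open>One factor is absorbed as a Gauss sum twisted by \<open>v\<close>. After exchanging the
  sums, orthogonality in \<open>v\<close> leaves only \<open>w = -1\<close>.\<close>

lemma gauss_squared: "gauss\<^sup>2 = quad_char (-1::'a) * q"
proof -
  have "gauss\<^sup>2 = (\<Sum>v\<in>UNIV. \<psi> v * (quad_char v * gauss))"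
    by (simp add: gauss_def power2_eq_square sum_distrib_right mult.assoc mult.left_commute)
  also have "\<dots> = (\<Sum>v\<in>UNIV. \<Sum>w\<in>UNIV. quad_char w * \<psi> ((1 + w) * v))"
  proof (intro sum.cong refl)
    fix v
    have "\<psi> v * (quad_char w * \<psi> (v * w)) = quad_char w * \<psi> ((1 + w) * v)" for w
    proof -
      have "\<psi> v * \<psi> (v * w) = \<psi> ((1 + w) * v)"
        by (simp add: algebra_simps flip: add)
      then show ?thesis by simp
    qed
    then show "\<psi> v * (quad_char v * gauss) = (\<Sum>w\<in>UNIV. quad_char w * \<psi> ((1 + w) * v))"
      by (simp only: twisted_gauss[symmetric] sum_distrib_left)
  qed
  also have "\<dots> = (\<Sum>w\<in>UNIV. quad_char w * (\<Sum>v\<in>UNIV. \<psi> ((1 + w) * v)))"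
    by (subst sum.swap) (simp add: sum_distrib_left)
  also have "\<dots> = (\<Sum>w\<in>(UNIV::'a set). if w = -1 then quad_char (-1::'a) * q else 0)"
    by (intro sum.cong) (auto simp: sum_psi add_eq_0_iff)
  finally show ?thesis by simp
qed

text \<open>Complete the square by the shift \<open>b / (2 * t)\<close>, then group by squares; the
  trivial part of the weight \<open>1 + quad_char u\<close> sums to 0 because
  \<open>t \<noteq> 0\<close>.\<close>

lemma gauss_quadratic:
  assumes "t \<noteq> 0"
  shows "(\<Sum>c\<in>UNIV. \<psi> (t * c\<^sup>2 + c * b)) = quad_char t * gauss * \<psi> (- b\<^sup>2 / (4 * t))"
proof -
  have sq: "t * (d + - b / (2 * t))\<^sup>2 + (d + - b / (2 * t)) * b = t * d\<^sup>2 + - b\<^sup>2 / (4 * t)" for d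
  proof -
    define e where "e = b / (2 * t)"
    have b: "b = 2 * t * e" using assms two by (simp add: e_def)
    have "b\<^sup>2 / (4 * t) = t * e\<^sup>2"
      using assms two four by (simp add: b power2_eq_square)
    moreover have "t * (d - e)\<^sup>2 + (d - e) * b = t * d\<^sup>2 - t * e\<^sup>2"
      unfolding b by (simp add: power2_eq_square algebra_simps)
    ultimately show ?thesis by (simp add: e_def)
  qed
  have "(\<Sum>c\<in>UNIV. \<psi> (t * c\<^sup>2 + c * b))
      = (\<Sum>d\<in>UNIV. \<psi> (t * (d + - b / (2 * t))\<^sup>2 + (d + - b / (2 * t)) * b))"
    by (intro sum.reindex_bij_betw[symmetric] bij_plus_right)
  also have "\<dots> = (\<Sum>d\<in>UNIV. \<psi> (t * d\<^sup>2)) * \<psi> (- b\<^sup>2 / (4 * t))"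
    by (simp only: sq add sum_distrib_right)
  also have "(\<Sum>d\<in>UNIV. \<psi> (t * d\<^sup>2)) = quad_char t * gauss"
    using assms sum_over_squares[OF two, of "\<lambda>u. \<psi> (t * u)"]
    by (simp add: distrib_right sum.distrib sum_psi twisted_gauss)
  finally show ?thesis .
qed

lemma sum_psi_vec: "(\<Sum>x\<in>(UNIV::('a ^ 'm) set). \<psi> (dot x y)) = q ^ CARD('m::finite) * of_bool (y = 0)"
proof -
  have "(\<Sum>x\<in>(UNIV::('a ^ 'm) set). \<psi> (dot x y)) = (\<Sum>x\<in>(UNIV::('a ^ 'm) set). \<Prod>i\<in>UNIV. \<psi> (y $ i * x $ i))"
    by (simp add: dot_def psi_sum mult.commute)
  also have "\<dots> = (\<Prod>i\<in>UNIV. q * of_bool (y $ i = 0))"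
    by (subst sum_vec_prod) (simp add: sum_psi)
  also have "\<dots> = q ^ CARD('m) * of_bool (y = 0)"
    by (auto simp: vec_eq_iff)
  finally show ?thesis .
qed

text \<open>The sum factors over the coordinates. Their number is even, so
  \<open>quad_char t\<close> disappears and the Gauss sums combine into powers of
  \<open>gauss\<^sup>2\<close>.\<close>

lemma sum_psi_qform:
  fixes y :: "'a ^ 'm::finite"
  assumes "t \<noteq> 0" and m: "CARD('m) = 2 * n"
  shows "(\<Sum>x\<in>UNIV. \<psi> (t * qform x + dot x y)) = (quad_char (-1::'a) * q) ^ n * \<psi> (- qform y / (4 * t))"
proof -
  have "(\<Sum>x\<in>UNIV. \<psi> (t * qform x + dot x y))
      = (\<Sum>x\<in>(UNIV::('a ^ 'm) set). \<Prod>i\<in>UNIV. \<psi> (t * (x $ i)\<^sup>2 + x $ i * y $ i))"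
    by (simp add: qform_def dot_def sum_distrib_left psi_sum flip: sum.distrib)
  also have "\<dots> = (\<Prod>i\<in>UNIV. quad_char t * gauss * \<psi> (- (y $ i)\<^sup>2 / (4 * t)))"
    by (subst sum_vec_prod) (simp add: gauss_quadratic[OF assms(1)])
  also have "\<dots> = (quad_char t * gauss) ^ CARD('m) * \<psi> (\<Sum>i\<in>UNIV. - (y $ i)\<^sup>2 / (4 * t))"
    by (simp add: prod.distrib psi_sum)
  also have "(\<Sum>i\<in>UNIV. - (y $ i)\<^sup>2 / (4 * t)) = - qform y / (4 * t)"
    by (simp only: qform_def sum_negf[symmetric] sum_divide_distrib)
  also have "(quad_char t * gauss) ^ CARD('m) = (quad_char (-1::'a) * q) ^ n"
    using quad_char_sq[OF assms(1)] by (simp add: m power_mult power_mult_distrib gauss_squared)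
  finally show ?thesis .
qed

section \<open>The Fourier transform of the connection set\<close>

lemma sum_sq_ind_psi:
  "(\<Sum>e\<in>UNIV. sq_ind e * \<psi> (t * e)) = (q * of_bool (t = 0) + quad_char t * gauss + 1) / 2"
proof -
  have "(\<Sum>e\<in>UNIV. sq_ind e * \<psi> (t * e))
      = (\<Sum>e\<in>UNIV. (\<psi> (t * e) + quad_char e * \<psi> (t * e) + (if e = 0 then 1 else 0)) / 2)"
    by (intro sum.cong) (auto simp: sq_ind_quad_char field_simps)
  then show ?thesis
    by (simp add: sum.distrib sum_psi twisted_gauss flip: sum_divide_distrib)
qed

text \<open>Fourier inversion on the field: the coefficients are the transform of
  \<open>sq_ind\<close> at \<open>- t\<close>, and orthogonality selects
  \<open>e = c\<close>.\<close>

lemma sq_ind_inversion: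
  "q * sq_ind c = (\<Sum>t\<in>UNIV. (q * of_bool (t = 0) + quad_char (- t) * gauss + 1) / 2 * \<psi> (t * c))"
proof -
  have "(\<Sum>t\<in>UNIV. (q * of_bool (t = 0) + quad_char (- t) * gauss + 1) / 2 * \<psi> (t * c))
      = (\<Sum>t\<in>UNIV. (\<Sum>e\<in>UNIV. sq_ind e * \<psi> (- t * e)) * \<psi> (t * c))"
    by (simp only: sum_sq_ind_psi neg_equal_0_iff_equal)
  also have "\<dots> = (\<Sum>t\<in>UNIV. \<Sum>e\<in>UNIV. sq_ind e * \<psi> ((c - e) * t))"
  proof (intro sum.cong refl)
    fix t
    have "sq_ind e * \<psi> (- t * e) * \<psi> (t * c) = sq_ind e * \<psi> ((c - e) * t)" for e
      by (simp add: mult.assoc algebra_simps flip: add)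
    then show "(\<Sum>e\<in>UNIV. sq_ind e * \<psi> (- t * e)) * \<psi> (t * c)
        = (\<Sum>e\<in>UNIV. sq_ind e * \<psi> ((c - e) * t))"
      by (simp only: sum_distrib_right)
  qed
  also have "\<dots> = (\<Sum>e\<in>UNIV. sq_ind e * (\<Sum>t\<in>UNIV. \<psi> ((c - e) * t)))"
    by (subst sum.swap) (simp add: sum_distrib_left)
  also have "\<dots> = (\<Sum>e\<in>UNIV. if e = c then q * sq_ind c else 0)"
    by (intro sum.cong) (auto simp: sum_psi)
  finally show ?thesis by simp
qed

definition fourier :: "'a ^ 'm::finite \<Rightarrow> complex" where
  "fourier y = (\<Sum>x\<in>UNIV. sq_ind (qform x) * \<psi> (dot x y))"

text \<open>The second Gauss sum produces \<open>gauss\<^sup>2\<close>, whose sign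
  \<open>quad_char (-1)\<close> turns \<open>c\<close> into \<open>- c\<close>. The final 1 is the
  omitted term \<open>s = 0\<close>.\<close>

lemma sum_nonzero_twisted:
  "(\<Sum>s\<in>UNIV - {0}. (1 + quad_char s * gauss) * \<psi> (s * c)) = 2 * q * sq_ind (- c) - q - 1"
proof -
  have "(\<Sum>s\<in>UNIV. (1 + quad_char s * gauss) * \<psi> (s * c))
      = (\<Sum>s\<in>UNIV. \<psi> (c * s)) + gauss * (\<Sum>s\<in>UNIV. quad_char s * \<psi> (c * s))"
    by (simp add: algebra_simps sum.distrib sum_distrib_left)
  also have "\<dots> = q * of_bool (c = 0) + quad_char c * gauss\<^sup>2"
    by (simp only: sum_psi twisted_gauss) (simp add: power2_eq_square)
  also have "\<dots> = q * (of_bool (c = 0) + quad_char (- c))"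
    using quad_char_mult[OF two, of "-1" c] by (simp add: gauss_squared algebra_simps)
  also have "\<dots> = 2 * q * sq_ind (- c) - q"
    by (simp add: sq_ind_quad_char algebra_simps)
  finally show ?thesis
    by (simp add: sum_diff1)
qed

text \<open>Expanding \<open>sq_ind\<close> in additive characters turns the transform into quadratic Gauss sums
  \<open>\<Sum>\<^sub>x \<psi> (t qform x + dot x y)\<close>. As \<open>m\<close> is even they carry no factor \<open>quad_char t\<close>, so the remaining
  sum over \<open>t\<close> is again a Gauss sum, after the substitution \<open>t = - 1 / (4 s)\<close>.\<close>
lemma fourier_formula:
  fixes y :: "'a ^ 'm::finite"
  assumes m: "CARD('m) = 2 * n"
  shows "q * fourier y = (q + 1) / 2 * q ^ CARD('m) * of_bool (y = 0)
    + (quad_char (-1::'a) * q) ^ n * (q * sq_ind (- qform y) - (q + 1) / 2)"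
proof -
  define D where "D = (quad_char (-1::'a) * q) ^ n"
  let ?T = "\<lambda>t::'a. (q * of_bool (t = 0) + quad_char (- t) * gauss + 1) / 2"
  have "q * fourier y = (\<Sum>x\<in>UNIV. (\<Sum>t\<in>UNIV. ?T t * \<psi> (t * qform x)) * \<psi> (dot x y))"
    by (simp only: fourier_def sum_distrib_left mult.assoc[symmetric] sq_ind_inversion)
  also have "\<dots> = (\<Sum>x\<in>UNIV. \<Sum>t\<in>UNIV. ?T t * \<psi> (t * qform x + dot x y))"
    by (simp only: sum_distrib_right mult.assoc add)
  also have "\<dots> = (\<Sum>t\<in>UNIV. ?T t * (\<Sum>x\<in>UNIV. \<psi> (t * qform x + dot x y)))"
    by (subst sum.swap) (simp only: sum_distrib_left)
  \<comment> \<open>The term \<open>t = 0\<close> has no quadratic part; orthogonality makes it a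
    point mass at the origin.\<close>
  also have "\<dots> = ?T 0 * (\<Sum>x\<in>UNIV. \<psi> (0 * qform x + dot x y))
      + (\<Sum>t\<in>UNIV - {0}. ?T t * (\<Sum>x\<in>UNIV. \<psi> (t * qform x + dot x y)))"
    by (rule sum.remove) auto
  also have "?T 0 * (\<Sum>x\<in>UNIV. \<psi> (0 * qform x + dot x y))
      = (q + 1) / 2 * q ^ CARD('m) * of_bool (y = 0)"
    by (simp add: sum_psi_vec)
  also have "(\<Sum>t\<in>UNIV - {0}. ?T t * (\<Sum>x\<in>UNIV. \<psi> (t * qform x + dot x y)))
      = (\<Sum>t\<in>UNIV - {0}. (1 + quad_char (- t) * gauss) / 2 * (D * \<psi> (- qform y / (4 * t))))"
    by (intro sum.cong refl) (simp add: sum_psi_qform[OF _ m] D_def)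
  also have "\<dots> = (\<Sum>s\<in>UNIV - {0}. D / 2 * ((1 + quad_char s * gauss) * \<psi> (s * qform y)))"
  proof (rule sum.reindex_bij_witness[of _ "\<lambda>s. - 1 / (4 * s)" "\<lambda>t. - 1 / (4 * t)"])
    fix t :: 'a assume "t \<in> UNIV - {0}"
    then have t: "t \<noteq> 0" by simp
    \<comment> \<open>The new variable is \<open>- t\<close> times a nonzero square, so both have
      the same quadratic character.\<close>
    have "- 1 / (4 * t) = - t * (1 / (2 * t))\<^sup>2"
      using t two four by (simp add: field_simps power2_eq_square)
    then have "quad_char (- 1 / (4 * t)) = quad_char (- t)"
      using quad_char_mult_square[of "1 / (2 * t)" "- t"] t two by simp
    then show "D / 2 * ((1 + quad_char (- 1 / (4 * t)) * gauss) * \<psi> (- 1 / (4 * t) * qform y))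
        = (1 + quad_char (- t) * gauss) / 2 * (D * \<psi> (- qform y / (4 * t)))"
      by simp
  qed (use four in auto)
  also have "\<dots> = D * (q * sq_ind (- qform y) - (q + 1) / 2)"
    by (simp only: sum_distrib_left[symmetric] sum_nonzero_twisted) (simp add: field_simps)
  finally show ?thesis by (simp add: D_def)
qed

section \<open>Fourier inversion and the self-convolution of the square indicator\<close>

lemma fourier_inversion:
  fixes a :: "'a ^ 'm::finite"
  shows "(\<Sum>y\<in>UNIV. fourier y * \<psi> (- dot a y)) = q ^ CARD('m) * sq_ind (qform a)"
proof -
  have "(\<Sum>y\<in>UNIV. fourier y * \<psi> (- dot a y))
      = (\<Sum>y\<in>UNIV. \<Sum>x\<in>UNIV. sq_ind (qform x) * \<psi> (dot y (x - a)))"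
    unfolding fourier_def sum_distrib_right mult.assoc add[symmetric]
    by (simp add: dot_diff_right dot_commute)
  also have "\<dots> = (\<Sum>x\<in>UNIV. sq_ind (qform x) * (\<Sum>y\<in>UNIV. \<psi> (dot y (x - a))))"
    by (subst sum.swap) (simp only: sum_distrib_left)
  also have "\<dots> = (\<Sum>x\<in>UNIV. if x = a then q ^ CARD('m) * sq_ind (qform a) else 0)"
    by (intro sum.cong) (auto simp: sum_psi_vec)
  finally show ?thesis by simp
qed

text \<open>Expand one factor \<open>fourier y\<close> by its definition and apply inversion at
  \<open>a - x\<close> to the other.\<close>

lemma fourier_squared_inversion:
  fixes a :: "'a ^ 'm::finite"
  shows "(\<Sum>y\<in>UNIV. (fourier y)\<^sup>2 * \<psi> (- dot a y))
    = q ^ CARD('m) * (\<Sum>x\<in>UNIV. sq_ind (qform x) * sq_ind (qform (a - x)))"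
proof -
  have "(\<Sum>y\<in>UNIV. (fourier y)\<^sup>2 * \<psi> (- dot a y))
      = (\<Sum>y\<in>UNIV. (\<Sum>x\<in>UNIV. sq_ind (qform x) * \<psi> (dot x y)) * (fourier y * \<psi> (- dot a y)))"
    by (simp only: power2_eq_square mult.assoc) (simp only: fourier_def)
  also have "\<dots> = (\<Sum>y\<in>UNIV. \<Sum>x\<in>UNIV. sq_ind (qform x) * (fourier y * \<psi> (- dot (a - x) y)))"
  proof (intro sum.cong refl)
    fix y :: "'a ^ 'm"
    have "\<psi> (dot x y) * (fourier y * \<psi> (- dot a y)) = fourier y * \<psi> (- dot (a - x) y)" for x
    proof -
      have "- dot (a - x) y = dot x y + - dot a y"
        by (simp add: dot_commute[of _ y] dot_diff_right)
      then show ?thesis by (simp only: add) (simp only: mult_ac)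
    qed
    then show "(\<Sum>x\<in>UNIV. sq_ind (qform x) * \<psi> (dot x y)) * (fourier y * \<psi> (- dot a y))
        = (\<Sum>x\<in>UNIV. sq_ind (qform x) * (fourier y * \<psi> (- dot (a - x) y)))"
      by (simp only: sum_distrib_right mult.assoc)
  qed
  also have "\<dots> = (\<Sum>x\<in>UNIV. sq_ind (qform x) * (\<Sum>y\<in>UNIV. fourier y * \<psi> (- dot (a - x) y)))"
    by (subst sum.swap) (simp only: sum_distrib_left)
  also have "\<dots> = q ^ CARD('m) * (\<Sum>x\<in>UNIV. sq_ind (qform x) * sq_ind (qform (a - x)))"
    by (simp add: fourier_inversion sum_distrib_left mult_ac)
  finally show ?thesis .
qed

text \<open>With \<open>A = (quad_char (-1) q)\<^sup>n / q\<close> and \<open>s = (q + 1) / 2\<close>, the transform takes the two values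
  \<open>A (q - s)\<close> and \<open>- A s\<close> off the origin.\<close>
lemma sq_ind_convolution:
  fixes a :: "'a ^ 'm::finite"
  assumes m: "CARD('m) = 2 * n" and "a \<noteq> 0"
  defines "A \<equiv> (quad_char (-1::'a) * q) ^ n / q" and "s \<equiv> (q + 1) / 2"
  shows "(\<Sum>x\<in>UNIV. sq_ind (qform x) * sq_ind (qform (a - x)))
    = s\<^sup>2 * q ^ CARD('m) / q\<^sup>2 + s * A - A * sq_ind (qform a)"
proof -
  define c where "c = s * q ^ CARD('m) / q"
  have F: "fourier y = c * of_bool (y = 0) + A * (q * sq_ind (- qform y) - s)" for y :: "'a ^ 'm"
  proof -
    have "fourier y = q * fourier y / q" by simp
    also have "\<dots> = c * of_bool (y = 0) + A * (q * sq_ind (- qform y) - s)"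
      unfolding fourier_formula[OF m] A_def s_def c_def by (simp add: add_divide_distrib)
    finally show ?thesis .
  qed
  have q: "q = 2 * s - 1" by (simp add: s_def field_simps)
  \<comment> \<open>By \<open>q = 2 * s - 1\<close>, the two values off the origin have sum
    \<open>- A\<close> and product \<open>- (A\<^sup>2 * (s\<^sup>2 - s))\<close>, hence the
    quadratic equation. The last summand corrects it at the origin.\<close>
  have F2: "(fourier y)\<^sup>2 = - A * fourier y + A\<^sup>2 * (s\<^sup>2 - s) + (c\<^sup>2 + c * A * q) * of_bool (y = 0)"
    for y :: "'a ^ 'm"
  proof (cases "y = 0")
    case True
    then have *: "fourier y = c + A * (q - s)" by (simp add: F sq_ind_def)
    show ?thesis unfolding * q using True by (simp add: algebra_simps power2_eq_square)
  next
    case False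
    then consider "fourier y = A * (q - s)" | "fourier y = - A * s"
      by (cases "is_square (- qform y)") (auto simp: F sq_ind_def)
    then show ?thesis
    proof cases
      case 1
      show ?thesis unfolding 1 q using False by (simp add: algebra_simps power2_eq_square)
    next
      case 2
      show ?thesis unfolding 2 using False by (simp add: algebra_simps power2_eq_square)
    qed
  qed
  have "(\<Sum>y\<in>UNIV. (fourier y)\<^sup>2 * \<psi> (- dot a y))
      = (\<Sum>y\<in>UNIV. - A * (fourier y * \<psi> (- dot a y)) + A\<^sup>2 * (s\<^sup>2 - s) * \<psi> (dot y (- a))
          + (if y = 0 then c\<^sup>2 + c * A * q else 0))"
  proof (intro sum.cong refl)
    fix y :: "'a ^ 'm"
    have "- dot a y = dot y (- a)" "dot a 0 = 0" by (simp_all add: dot_def sum_negf mult.commute)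
    then show "(fourier y)\<^sup>2 * \<psi> (- dot a y)
        = - A * (fourier y * \<psi> (- dot a y)) + A\<^sup>2 * (s\<^sup>2 - s) * \<psi> (dot y (- a))
          + (if y = 0 then c\<^sup>2 + c * A * q else 0)"
      unfolding F2 by (cases "y = 0") (simp_all add: algebra_simps)
  qed
  \<comment> \<open>Inversion evaluates the linear term; the constant term cancels by orthogonality
    as \<open>a \<noteq> 0\<close>.\<close>
  also have "\<dots> = - A * (q ^ CARD('m) * sq_ind (qform a)) + (c\<^sup>2 + c * A * q)"
    using \<open>a \<noteq> 0\<close>
    by (simp add: sum.distrib sum_subtractf sum_negf fourier_inversion sum_psi_vec
        flip: sum_distrib_left)
  finally have "q ^ CARD('m) * (\<Sum>x\<in>UNIV. sq_ind (qform x) * sq_ind (qform (a - x)))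
      = q ^ CARD('m) * (s\<^sup>2 * q ^ CARD('m) / q\<^sup>2 + s * A - A * sq_ind (qform a))"
    unfolding fourier_squared_inversion c_def
    by (simp add: field_simps power2_eq_square)
  then show ?thesis by simp
qed

text \<open>This sum is the transform at the origin.\<close>

lemma sum_sq_ind_qform:
  assumes m: "CARD('m::finite) = 2 * n"
  shows "(\<Sum>x\<in>UNIV. sq_ind (qform (x :: 'a ^ 'm)))
    = (q + 1) / 2 * q ^ CARD('m) / q + (quad_char (-1::'a) * q) ^ n / q * ((q - 1) / 2)"
proof -
  have "(\<Sum>x\<in>UNIV. sq_ind (qform (x :: 'a ^ 'm))) = fourier (0 :: 'a ^ 'm)"
    by (simp add: fourier_def dot_def)
  also have "\<dots> = q * fourier (0 :: 'a ^ 'm) / q" by simp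
  also have "\<dots> = (q + 1) / 2 * q ^ CARD('m) / q + (quad_char (-1::'a) * q) ^ n / q * ((q - 1) / 2)"
    unfolding fourier_formula[OF m] by (simp add: sq_ind_def field_simps)
  finally show ?thesis .
qed

end

section \<open>The quadrance graph\<close>

lemma sq_dist_qform: "sq_dist x y = qform (x - y)"
  by (simp add: sq_dist_def qform_def)

lemma parcs_quadrance_graph:
  "(x, y) \<in> parcs (quadrance_graph :: ('a::{field,finite} ^ 'm) pair_pre_digraph)
    \<longleftrightarrow> x \<noteq> y \<and> is_square (qform (x - y))"
  by (simp add: quadrance_graph_def sq_dist_qform)

lemma neighbors_quadrance_graph:
  "neighbors (quadrance_graph :: ('a::{field,finite} ^ 'm) pair_pre_digraph) x
    = {y. y \<noteq> x \<and> is_square (qform (x - y))}"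
  by (auto simp: neighbors_def parcs_quadrance_graph) (simp_all add: quadrance_graph_def)

lemma pair_graph_quadrance_graph:
  "pair_graph (quadrance_graph :: ('a::{field,finite} ^ 'm::finite) pair_pre_digraph)"
proof
  show "symmetric (with_proj (quadrance_graph :: ('a ^ 'm) pair_pre_digraph))"
    unfolding symmetric_def sym_def
    by (auto simp: quadrance_graph_def sq_dist_qform qform_diff_commute)
qed (auto simp: quadrance_graph_def)

text \<open>Translation invariance; the subtracted 1 is the vertex \<open>x\<close> itself, at
  distance 0.\<close>

lemma card_neighbors:
  fixes x :: "'a::{field,finite} ^ 'm::finite"
  shows "of_nat (card (neighbors quadrance_graph x)) = (\<Sum>z\<in>UNIV. sq_ind (qform (z :: 'a ^ 'm))) - 1"
proof -
  have "(\<Sum>z\<in>UNIV. sq_ind (qform (z :: 'a ^ 'm))) = (\<Sum>y\<in>UNIV. sq_ind (qform (x - y)))"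
    by (rule sum.reindex_bij_witness[of _ "\<lambda>y. x - y" "\<lambda>y. x - y"]) auto
  also have "\<dots> = of_nat (card {y. is_square (qform (x - y))})"
    by (simp add: sq_ind_def of_bool_def sum.If_cases)
  also have "{y. is_square (qform (x - y))} = insert x (neighbors quadrance_graph x)"
    by (auto simp: neighbors_quadrance_graph)
  finally show ?thesis
    by (simp add: neighbors_quadrance_graph)
qed

text \<open>Substituting \<open>x - z\<close> for \<open>z\<close> turns the convolution at
  \<open>x - y\<close> into a count of vertices at square distance from both. It includes
  \<open>x\<close> and \<open>y\<close> themselves exactly when these are adjacent.\<close>

lemma card_common_neighbors:
  fixes x y :: "'a::{field,finite} ^ 'm::finite"
  assumes "x \<noteq> y"
  shows "of_nat (card (neighbors quadrance_graph x \<inter> neighbors quadrance_graph y))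
    = (\<Sum>z\<in>UNIV. sq_ind (qform z) * sq_ind (qform (x - y - z))) - 2 * sq_ind (qform (x - y))"
proof -
  let ?C = "{z. is_square (qform (x - z)) \<and> is_square (qform (y - z))}"
  let ?N = "neighbors quadrance_graph x \<inter> neighbors quadrance_graph y"
  have "(\<Sum>z\<in>UNIV. sq_ind (qform z) * sq_ind (qform (x - y - z)))
      = (\<Sum>z\<in>UNIV. sq_ind (qform (x - z)) * sq_ind (qform (y - z)))"
  proof (rule sum.reindex_bij_witness[of _ "\<lambda>z. x - z" "\<lambda>z. x - z"])
    fix z
    have "y - (x - z) = z - (x - y)" by simp
    then have "qform (y - (x - z)) = qform (x - y - z)"
      by (simp only: qform_diff_commute[of z "x - y"])
    then show "sq_ind (qform (x - (x - z))) * sq_ind (qform (y - (x - z)))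
        = sq_ind (qform z) * sq_ind (qform (x - y - z))"
      by simp
  qed auto
  also have "\<dots> = of_nat (card ?C)"
    by (simp add: sq_ind_def flip: of_bool_conj)
  also have "\<dots> = of_nat (card ?N) + 2 * sq_ind (qform (x - y))"
  proof (cases "is_square (qform (x - y))")
    case True
    then have "?C = insert x (insert y ?N)"
      by (auto simp: neighbors_quadrance_graph qform_diff_commute[of y x])
    moreover have "card (insert x (insert y ?N)) = Suc (Suc (card ?N))"
      using assms by (simp add: neighbors_quadrance_graph)
    ultimately show ?thesis using True by (simp add: sq_ind_def)
  next
    case False
    then have "?C = ?N"
      by (auto simp: neighbors_quadrance_graph qform_diff_commute[of y x])
    then show ?thesis using False by (simp add: sq_ind_def)
  qed
  finally show ?thesis by simp
qed

section \<open>Evaluation of the parameters in both residue classes of q modulo 4\<close>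

theorem mainTheorem1:
  fixes q m :: nat
  assumes "primepow q" and "odd q" and "CARD('a::{field,finite}) = q"
    and "even m" and "m \<ge> 4" and "CARD('m::finite) = m"
  shows "\<exists>k l mu :: nat.
    strongly_regular (quadrance_graph :: ('a ^ 'm) pair_pre_digraph) (q ^ m) k l mu \<and>
    ([q = 1] (mod 4) \<longrightarrow>
      real k = 1/2 * (real q ^ m + real q ^ (m - 1)
                      + real q ^ (m div 2) - real q ^ (m div 2 - 1)) - 1) \<and>
    ([q = 3] (mod 4) \<longrightarrow>
      real k = 1/2 * (real q ^ m + real q ^ (m - 1)
                      + (- real q) ^ (m div 2) + (- real q) ^ (m div 2 - 1)) - 1) \<and>
    real l = 1/4 * (real q ^ (m - 2) * (real q + 1) ^ 2
                    + 2 * (- 1) ^ (m * (q - 1) div 4) * real q ^ (m div 2 - 1) * (real q - 1)) - 2 \<and>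
    ([q = 1] (mod 4) \<longrightarrow>
      real mu = 1/4 * real q ^ (m div 2 - 1) * (real q + 1)
                * (real q ^ (m div 2) + real q ^ (m div 2 - 1) + 2)) \<and>
    ([q = 3] (mod 4) \<longrightarrow>
      real mu = 1/4 * real q ^ (m div 2 - 1) * (real q + 1)
                * (real q ^ (m div 2) + real q ^ (m div 2 - 1) + 2 * (- 1) ^ (m div 2)))"
proof -
  note odd = \<open>odd q\<close>[folded \<open>CARD('a) = q\<close>]
  note two = two_neq_zero_if_odd_card[OF odd]
  obtain n where n: "m = 2 * (n + 1)"
  proof
    show "m = 2 * (m div 2 - 1 + 1)" using \<open>even m\<close> \<open>m \<ge> 4\<close> by presburger
  qed
  then have m: "CARD('m) = 2 * (n + 1)" using assms by simp
  obtain \<psi> :: "'a \<Rightarrow> complex" where "\<And>x y. \<psi> (x + y) = \<psi> x * \<psi> y" "\<And>x. \<psi> x \<noteq> 0" "\<exists>x. \<psi> x \<noteq> 1"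
    using exists_additive_character[where 'a = 'a] by auto
  then interpret additive_character \<psi> "of_nat q"
    using two assms by unfold_locales auto
  \<comment> \<open>This sign is \<open>quad_char (-1)\<close> to the power \<open>m div 2\<close>;
    it unites the two residue classes until the end.\<close>
  define \<delta> :: real where "\<delta> = (- 1) ^ (m * (q - 1) div 4)"
  have "q \<ge> 3" using \<open>odd q\<close> card_field_ge_2[where 'a = 'a] assms(3) by (cases "q = 2") auto
  have mod4: "q mod 4 = 1 \<or> q mod 4 = 3" using \<open>odd q\<close> by presburger
  have \<delta>1: "\<delta> = 1" if "q mod 4 = 1"
  proof -
    have "q = 4 * (q div 4) + 1" using that by presburger
    then obtain j where "q = 4 * j + 1" by blast
    then show ?thesis by (simp add: \<delta>_def n power_mult)
  qed
  have \<delta>3: "\<delta> = (- 1) ^ (n + 1)" if "q mod 4 = 3"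
  proof -
    have "q = 4 * (q div 4) + 3" using that by presburger
    then obtain j where "q = 4 * j + 3" by blast
    then have "m * (q - 1) = 4 * ((2 * j + 1) * (n + 1))" by (simp add: n algebra_simps)
    then have "m * (q - 1) div 4 = (2 * j + 1) * (n + 1)"
      by (simp only: nonzero_mult_div_cancel_left[OF zero_neq_numeral[symmetric]])
    then have "\<delta> = ((- 1) ^ (2 * j + 1)) ^ (n + 1)"
      by (simp only: \<delta>_def power_mult)
    then show ?thesis by simp
  qed
  have \<eta>: "quad_char (- 1 :: 'a) ^ (n + 1) = of_real \<delta>"
    using mod4 \<delta>1 \<delta>3 is_square_minus_one_iff[OF odd] assms(3) by (auto simp: quad_char_def)
  define A where "A = \<delta> * real q ^ n"
  have A: "(quad_char (-1::'a) * of_nat q) ^ (n + 1) / of_nat q = complex_of_real A"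
    unfolding A_def power_mult_distrib \<eta> using \<open>q \<ge> 3\<close> by simp
  define K where "K = (real q + 1) / 2 * real q ^ (2 * n + 1) + A * (real q - 1) / 2"
  \<comment> \<open>The value of the convolution at a vector whose \<open>qform\<close> is not a
    square; at other nonzero vectors it is \<open>R - A\<close>.\<close>
  define R where "R = ((real q + 1) / 2)\<^sup>2 * real q ^ (2 * n) + (real q + 1) / 2 * A"
  let ?G = "quadrance_graph :: ('a ^ 'm) pair_pre_digraph"
  have "(\<Sum>z\<in>UNIV. sq_ind (qform (z :: 'a ^ 'm))) = complex_of_real K"
    unfolding sum_sq_ind_qform[OF m] A K_def using \<open>q \<ge> 3\<close> by (simp add: m)
  note K = this
  have k: "real (card (neighbors ?G x)) = K - 1" for x
  proof -
    have "complex_of_real (real (card (neighbors ?G x))) = complex_of_real (K - 1)"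
      using card_neighbors[of x] by (simp add: K)
    then show ?thesis unfolding of_real_eq_iff .
  qed
  have r: "real (card (neighbors ?G x \<inter> neighbors ?G y))
      = R - (A + 2) * of_bool (is_square (qform (x - y)))" if "x \<noteq> y" for x y
  proof -
    have *: "x - y \<noteq> 0" using that by simp
    have "complex_of_real (real (card (neighbors ?G x \<inter> neighbors ?G y)))
        = complex_of_real (R - (A + 2) * of_bool (is_square (qform (x - y))))"
      unfolding of_real_of_nat_eq card_common_neighbors[OF that] sq_ind_convolution[OF m *] A
      using \<open>q \<ge> 3\<close> by (simp add: R_def sq_ind_def m power2_eq_square)
    then show ?thesis unfolding of_real_eq_iff .
  qed
  \<comment> \<open>An adjacent and a non-adjacent pair show that the values of \<open>l\<close> and \<open>mu\<close> are naturals.\<close>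
  have "\<exists>a :: 'a ^ 'm. a \<noteq> 0 \<and> is_square (qform a)"
  proof -
    obtain i :: 'm where True by simp
    have "qform (axis i (1::'a)) = 1"
      by (simp add: qform_def axis_def if_distrib[of "\<lambda>x. x\<^sup>2"] cong: if_cong)
    moreover have "axis i (1::'a) \<noteq> 0" by (simp add: axis_eq_0_iff)
    ultimately show ?thesis by (metis is_nth_power_1)
  qed
  then obtain a :: "'a ^ 'm" where a: "a \<noteq> 0" "is_square (qform a)" by blast
  \<comment> \<open>If every value were a square, then \<open>K = q ^ m\<close>, which forces
    \<open>A = q ^ (2 * n + 1)\<close>; but \<open>A\<close> is at most
    \<open>q ^ n\<close>.\<close>
  have "\<exists>b :: 'a ^ 'm. \<not> is_square (qform b)"
  proof (rule ccontr)
    assume "\<not> ?thesis"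
    then have "(\<Sum>z\<in>UNIV. sq_ind (qform (z :: 'a ^ 'm))) = of_nat CARD('a ^ 'm)"
      by (simp add: sq_ind_def)
    then have "complex_of_real K = complex_of_real (real q ^ m)"
      using assms by (simp add: K)
    then have "K = real q ^ m" unfolding of_real_eq_iff .
    then have "(real q - 1) * real q ^ (2 * n + 1) = (real q - 1) * A"
      by (simp add: K_def n field_simps)
    then have "real q ^ (2 * n + 1) = A" using \<open>q \<ge> 3\<close> by simp
    also have "\<dots> \<le> real q ^ n"
      by (cases "even (m * (q - 1) div 4)") (simp_all add: A_def \<delta>_def)
    also have "\<dots> < real q ^ (2 * n + 1)" using \<open>q \<ge> 3\<close> by (intro power_strict_increasing) auto
    finally show False by simp
  qed
  then obtain b :: "'a ^ 'm" where b: "\<not> is_square (qform b)" by blast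
  then have "b \<noteq> 0" by auto
  define k l mu where "k = card (neighbors ?G 0)"
    and "l = card (neighbors ?G a \<inter> neighbors ?G 0)"
    and "mu = card (neighbors ?G b \<inter> neighbors ?G 0)"
  have real: "real k = K - 1" "real l = R - A - 2" "real mu = R"
    unfolding k_def l_def mu_def using k r[OF a(1)] r[OF \<open>b \<noteq> 0\<close>] a b by simp_all
  have srg: "strongly_regular ?G (q ^ m) k l mu"
    unfolding strongly_regular_def
  proof (intro conjI ballI impI pair_graph_quadrance_graph)
    show "card (pverts ?G) = q ^ m" using assms by (simp add: quadrance_graph_def)
    show "card (neighbors ?G x) = k" for x
      using k[of x] real(1) by simp
    show "card (neighbors ?G x \<inter> neighbors ?G y) = l" if "(x, y) \<in> parcs ?G" for x y
      using that r[of x y] real(2) by (simp add: parcs_quadrance_graph)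
    show "card (neighbors ?G x \<inter> neighbors ?G y) = mu" if "x \<noteq> y \<and> (x, y) \<notin> parcs ?G" for x y
    proof -
      have "x \<noteq> y" "\<not> is_square (qform (x - y))" using that by (auto simp: parcs_quadrance_graph)
      then show ?thesis using r[of x y] real(3) by simp
    qed
  qed
  have e: "m - 1 = 2 * n + 1" "m - 2 = 2 * n" "m div 2 = n + 1" "m div 2 - 1 = n"
    "real q ^ (2 * n) = real q ^ n * real q ^ n"
    by (simp_all add: n mult_2 power_add)
  have k': "real k = 1/2 * (real q ^ m + real q ^ (m - 1)
      + \<delta> * (real q ^ (m div 2) - real q ^ (m div 2 - 1))) - 1"
    using e by (simp add: real K_def A_def n field_simps)
  have l': "real l = 1/4 * (real q ^ (m - 2) * (real q + 1) ^ 2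
      + 2 * \<delta> * real q ^ (m div 2 - 1) * (real q - 1)) - 2"
    using e by (simp add: real R_def A_def power2_eq_square field_simps)
  have mu': "real mu = 1/4 * real q ^ (m div 2 - 1) * (real q + 1)
      * (real q ^ (m div 2) + real q ^ (m div 2 - 1) + 2 * \<delta>)"
    using e by (simp add: real R_def A_def power2_eq_square field_simps)
  have cases: "[q = 1] (mod 4) \<longleftrightarrow> q mod 4 = 1" "[q = 3] (mod 4) \<longleftrightarrow> q mod 4 = 3"
    by (simp_all add: cong_def)
  have sign: "(- real q) ^ j = (- 1) ^ j * real q ^ j" for j
    by (rule power_minus)
  show ?thesis
  proof (intro exI conjI impI)
    show "strongly_regular ?G (q ^ m) k l mu" by (fact srg)
    show "real l = 1/4 * (real q ^ (m - 2) * (real q + 1) ^ 2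
        + 2 * (- 1) ^ (m * (q - 1) div 4) * real q ^ (m div 2 - 1) * (real q - 1)) - 2"
      using l' unfolding \<delta>_def .
  next
    assume "[q = 1] (mod 4)"
    then have \<delta>: "\<delta> = 1" using \<delta>1 cases by blast
    show "real k = 1/2 * (real q ^ m + real q ^ (m - 1)
        + real q ^ (m div 2) - real q ^ (m div 2 - 1)) - 1"
      using k' unfolding \<delta> by simp
    show "real mu = 1/4 * real q ^ (m div 2 - 1) * (real q + 1)
        * (real q ^ (m div 2) + real q ^ (m div 2 - 1) + 2)"
      using mu' unfolding \<delta> by simp
  next
    assume "[q = 3] (mod 4)"
    then have \<delta>: "\<delta> = (- 1) ^ (n + 1)" using \<delta>3 cases by blast
    \<comment> \<open>The exponents \<open>n + 1\<close> and \<open>n\<close> have opposite parity,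
      so the difference multiplied by \<open>\<delta>\<close> becomes a sum of powers of
      \<open>- q\<close>.\<close>
    show "real k = 1/2 * (real q ^ m + real q ^ (m - 1)
        + (- real q) ^ (m div 2) + (- real q) ^ (m div 2 - 1)) - 1"
      using k' unfolding \<delta> sign e by (simp add: algebra_simps)
    show "real mu = 1/4 * real q ^ (m div 2 - 1) * (real q + 1)
        * (real q ^ (m div 2) + real q ^ (m div 2 - 1) + 2 * (- 1) ^ (m div 2))"
      using mu' unfolding \<delta> e .
  qed
qed

end
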